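(* Let $d \geq 1$ be an integer. If $K \subset \mathbb{R}^d$ is a convex body, then $$\Delta_{KB}(K) \, \geq \, \exp\bigg( \frac{d}{2^{15} L_K^2} \bigg) \cdot 2^{-d}.$$
   Context: A convex body in $\mathbb{R}^d$ is a compact convex set with non-empty interior, and $|A|$ denotes the $d$-dimensional volume (Lebesgue measure) of $A \subset \mathbb{R}^d$. The Kövner--Besicovitch measure of symmetry of a convex body $K \subset \mathbb{R}^d$ is $$\Delta_{KB}(K) := \max_{x \in \mathbb{R}^d} \frac{|K \cap (x - K)|}{|K|},$$ where $x - K = \{x - y : y \in K\}$. The isotropic constant of $K$ is $$L_K = \left( \frac{\sqrt{\det(\Sigma_K)}}{|K|} \right)^{1/d},$$ where $\Sigma_K = \mathbb{E}\big[(X - \mathbb{E}[X]) \otimes (X - \mathbb{E}[X])\big]$ is the covariance matrix of a uniformly random point $X$ of $K$. Equivalently, there exists an affine transformation mapping $K$ to a convex body $K'$ of volume $1$ with $\Sigma_{K'} = L_K^2 I_d$, where $I_d$ is the identity matrix. *)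

theory Defs
  imports "HOL-Analysis.Analysis"
begin

definition convex_body :: "(real ^ 'd) set \<Rightarrow> bool" where
  "convex_body K \<longleftrightarrow> compact K \<and> convex K \<and> interior K \<noteq> {}"

abbreviation vol :: "(real ^ 'd) set \<Rightarrow> real" where
  "vol A \<equiv> measure lebesgue A"

definition symmetry_ratio :: "(real ^ 'd) set \<Rightarrow> real ^ 'd \<Rightarrow> real" where
  "symmetry_ratio K x = vol (K \<inter> (\<lambda>y. x - y) ` K) / vol K"

text \<open>For convex bodies the supremum below is a maximum; see \<open>Delta_KB_is_max\<close>.\<close>

definition Delta_KB :: "(real ^ 'd) set \<Rightarrow> real" where
  "Delta_KB K = (SUP x. symmetry_ratio K x)"

definition outer_product :: "real ^ 'd \<Rightarrow> real ^ 'd \<Rightarrow> real ^ 'd ^ 'd" where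
  "outer_product u v = (\<chi> i j. u $ i * v $ j)"

definition barycenter :: "(real ^ 'd) set \<Rightarrow> real ^ 'd" where
  "barycenter K = (LINT x|uniform_measure lebesgue K. x)"

definition covariance_matrix :: "(real ^ 'd) set \<Rightarrow> real ^ 'd ^ 'd" where
  "covariance_matrix K =
     (LINT x|uniform_measure lebesgue K. outer_product (x - barycenter K) (x - barycenter K))"

definition isotropic_constant :: "(real ^ 'd) set \<Rightarrow> real" where
  "isotropic_constant K = (sqrt (det (covariance_matrix K)) / vol K) powr (1 / real CARD('d))"

lemma compact_Int_reflection:
  fixes K :: "(real ^ 'd) set"
  assumes "compact K"
  shows "compact (K \<inter> (\<lambda>y. x - y) ` K)"
proof -
  have "compact ((\<lambda>y. x - y) ` K)"
    by (intro compact_continuous_image continuous_intros assms)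
  then show ?thesis
    using assms by (simp add: compact_Int)
qed

lemma vol_Int_reflection_upper_semicontinuous:
  fixes K :: "(real ^ 'd) set"
  assumes K: "compact K" and x: "x \<longlonglongrightarrow> a"
    and l: "(\<lambda>n. vol (K \<inter> (\<lambda>y. x n - y) ` K)) \<longlonglongrightarrow> l"
  shows "l \<le> vol (K \<inter> (\<lambda>y. a - y) ` K)"
proof -
  define B where "B n = K \<inter> (\<lambda>y. x n - y) ` K" for n
  define A where "A n = (\<Union>m\<in>{n..}. B m)" for n
  have Bm: "B n \<in> lmeasurable" for n
    unfolding B_def using compact_Int_reflection[OF K] by (rule lmeasurable_compact)
  have Km: "K \<in> lmeasurable" using K by (rule lmeasurable_compact)
  have As: "A n \<in> sets lebesgue" for n
    unfolding A_def using Bm by (intro sets.countable_UN') (auto simp: fmeasurable_def)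
  have AK: "A n \<subseteq> K" for n by (auto simp: A_def B_def)
  have Am: "A n \<in> lmeasurable" for n
    using fmeasurableI2[OF Km AK As] .
  have dec: "decseq A" unfolding decseq_def A_def by force
  have lim: "(\<lambda>n. vol (A n)) \<longlonglongrightarrow> vol (\<Inter>n. A n)"
    by (rule Lim_measure_decseq) (use As dec fmeasurableD2[OF Am] in auto)
  have sub: "(\<Inter>n. A n) \<subseteq> K \<inter> (\<lambda>y. a - y) ` K"
  proof
    fix y assume y: "y \<in> (\<Inter>n. A n)"
    then have yK: "y \<in> K" using AK by blast
    have ex: "\<exists>m\<ge>n. x m - y \<in> K" for n
    proof -
      have "y \<in> A n" using y by blast
      then obtain m z where "m \<ge> n" "z \<in> K" "y = x m - z"
        unfolding A_def B_def by auto
      then show ?thesis by (intro exI[of _ m]) auto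
    qed
    have "a - y \<in> K"
    proof (rule ccontr)
      assume "a - y \<notin> K"
      moreover have "open (- K)" using K by (simp add: compact_imp_closed open_Compl)
      moreover have "(\<lambda>n. x n - y) \<longlonglongrightarrow> a - y"
        by (intro tendsto_intros x)
      ultimately have "\<forall>\<^sub>F n in sequentially. x n - y \<in> - K"
        by (intro topological_tendstoD) auto
      then obtain N where "\<forall>n\<ge>N. x n - y \<in> - K"
        unfolding eventually_sequentially by blast
      then show False using ex[of N] by blast
    qed
    then have "y \<in> (\<lambda>y. a - y) ` K"
      by (intro image_eqI[of _ _ "a - y"]) auto
    then show "y \<in> K \<inter> (\<lambda>y. a - y) ` K" using yK by blast
  qed
  have "l \<le> vol (\<Inter>n. A n)"
  proof (rule LIMSEQ_le[OF l lim], intro exI allI impI)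
    fix n :: nat
    have "B n \<subseteq> A n" unfolding A_def by blast
    then have "vol (B n) \<le> vol (A n)"
      by (rule measure_mono_fmeasurable[OF _ fmeasurableD[OF Bm] Am])
    then show "vol (K \<inter> (\<lambda>y. x n - y) ` K) \<le> vol (A n)"
      by (simp only: B_def)
  qed
  also have "\<dots> \<le> vol (K \<inter> (\<lambda>y. a - y) ` K)"
    by (rule measure_mono_fmeasurable[OF sub])
      (use As lmeasurable_compact[OF compact_Int_reflection[OF K]] in auto)
  finally show ?thesis .
qed

lemma Delta_KB_is_max:
  fixes K :: "(real ^ 'd) set"
  assumes "convex_body K"
  shows "\<exists>x. symmetry_ratio K x = Delta_KB K" and "symmetry_ratio K z \<le> Delta_KB K"
proof -
  have K: "compact K" using assms by (simp add: convex_body_def)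
  have Km: "K \<in> lmeasurable" using K by (rule lmeasurable_compact)
  define f where "f x = vol (K \<inter> (\<lambda>y. x - y) ` K)" for x
  define S where "S = {u + v | u v. u \<in> K \<and> v \<in> K}"
  have S: "compact S" unfolding S_def using K K by (rule compact_sums)
  have zero: "f x = 0" if "x \<notin> S" for x
  proof -
    have "u + (x - u) \<in> S" if "u \<in> K" "x - u \<in> K" for u
      unfolding S_def using that by blast
    then have "K \<inter> (\<lambda>y. x - y) ` K = {}"
      using \<open>x \<notin> S\<close> by (auto simp: S_def)
    then show ?thesis by (simp add: f_def)
  qed
  have le: "f x \<le> vol K" for x
    unfolding f_def
    by (rule measure_mono_fmeasurable)
      (use Km lmeasurable_compact[OF compact_Int_reflection[OF K]] in auto)
  have bdd: "bdd_above (range f)" using le by (auto intro!: bdd_aboveI)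
  have "Sup (range f) \<in> closure (range f)"
    by (rule closure_contains_Sup[OF _ bdd]) simp
  then obtain g where g: "\<And>n. g n \<in> range f" "g \<longlonglongrightarrow> Sup (range f)"
    unfolding closure_sequential by blast
  have "\<forall>n. \<exists>x. g n = f x" using g(1) by blast
  then obtain x where x: "\<And>n. g n = f (x n)" by metis
  have "\<exists>a. Sup (range f) \<le> f a"
  proof (cases "Sup (range f) \<le> 0")
    case True
    then show ?thesis by (intro exI[of _ 0]) (simp add: f_def order.trans[OF _ measure_nonneg])
  next
    case False
    then have "\<forall>\<^sub>F n in sequentially. g n > 0"
      using g(2) by (auto intro: order_tendstoD)
    then obtain N where "\<And>n. n \<ge> N \<Longrightarrow> g n > 0"
      unfolding eventually_sequentially by blast
    then have "x (n + N) \<in> S" for n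
      using zero[of "x (n + N)"] x[of "n + N"] by (metis le_add2 less_irrefl)
    then obtain a r where r: "strict_mono r" "(\<lambda>n. x (r n + N)) \<longlonglongrightarrow> a"
      using S unfolding compact_eq_seq_compact_metric seq_compact_def o_def
      by (elim allE[of _ "\<lambda>n. x (n + N)"]) blast
    have "(\<lambda>n. g (n + N)) \<longlonglongrightarrow> Sup (range f)" using g(2) by (rule LIMSEQ_ignore_initial_segment)
    from LIMSEQ_subseq_LIMSEQ[OF this r(1)]
    have "(\<lambda>n. f (x (r n + N))) \<longlonglongrightarrow> Sup (range f)" by (simp add: o_def x)
    then have "Sup (range f) \<le> f a"
      unfolding f_def by (rule vol_Int_reflection_upper_semicontinuous[OF K r(2)])
    then show ?thesis ..
  qed
  then obtain a where a: "Sup (range f) \<le> f a" ..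
  have fa: "symmetry_ratio K x \<le> symmetry_ratio K a" for x
  proof -
    have "f x \<le> f a" using cSup_upper[OF _ bdd, of "f x"] a by auto
    then show ?thesis
      unfolding symmetry_ratio_def f_def by (intro divide_right_mono) auto
  qed
  have "Delta_KB K = symmetry_ratio K a"
    unfolding Delta_KB_def by (rule cSup_eq_maximum) (use fa in auto)
  then show "\<exists>x. symmetry_ratio K x = Delta_KB K" and "symmetry_ratio K z \<le> Delta_KB K"
    using fa by auto
qed

end

theory Submission
  imports Defs "HOL-Probability.Distributions"
begin

text \<open>
  Put \<open>M = 2\<^sup>d * Delta_KB K\<close>, where \<open>d\<close> is the dimension; the claim is that \<open>M\<close> is at least
  \<open>exp (d / (2\<^sup>1\<^sup>5 L\<^sup>2))\<close>, with \<open>L\<close> the isotropic constant. If \<open>X\<close> and \<open>Y\<close> are independent and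
  uniform on \<open>K\<close>, the density of \<open>(X + Y) / 2\<close> at \<open>z\<close> is \<open>2\<^sup>d\<close> times the volume of
  \<open>K \<inter> (2z - K)\<close> over the square of the volume of \<open>K\<close>, so it is at most \<open>M\<close> times the uniform
  density. If \<open>M\<close> were close to \<open>1\<close>, averaging would thus hardly concentrate the distribution,
  although it halves the covariance.

  Iterating makes the two effects contradict each other. Replacing a law by that of the midpoint of
  two independent copies squares the bound on the density and multiplies it by \<open>M\<close> (relative to the
  uniform density). After \<open>k\<close> rounds, with \<open>n = 2\<^sup>k\<close>, one has the average of \<open>n\<close> independent
  uniform points: its density is at most \<open>M\<^sup>n\<^sup>-\<^sup>1\<close> times the uniform one
  (\<open>funpow_self_average_bound\<close>), and its covariance is \<open>1 / n\<close> times that of \<open>K\<close>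
  (\<open>funpow_self_average_moments\<close>). A law with small covariance must have a large density
  somewhere. Testing both facts against a Gaussian whose covariance is that of the average gives
  \<open>exp (- d / 2) \<le> M\<^sup>n\<^sup>-\<^sup>1 * (L * sqrt (2 * pi / n))\<^sup>d\<close> (\<open>self_average_gaussian_bound\<close>).

  When \<open>n\<close> is at least \<open>2 * pi * exp 2 * L\<^sup>2\<close>, the last factor is at most \<open>exp (- d)\<close>, so
  \<open>M\<^sup>n\<^sup>-\<^sup>1\<close> is at least \<open>exp (d / 2)\<close>. The least such power of two is less than twice that
  threshold, hence of order \<open>L\<^sup>2\<close>, and taking roots gives the theorem.
\<close>

section \<open>The midpoint of two independent points\<close>

definition self_average :: "'a::euclidean_space measure \<Rightarrow> 'a measure" where
  "self_average \<mu> = distr (\<mu> \<Otimes>\<^sub>M \<mu>) borel (\<lambda>(x, y). (1/2) *\<^sub>R (x + y))"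

lemma sets_self_average [simp, measurable_cong]: "sets (self_average \<mu>) = sets borel"
  by (simp add: self_average_def)

lemma measurable_average [measurable]:
  fixes \<mu> :: "'a::euclidean_space measure"
  assumes [measurable_cong]: "sets \<mu> = sets borel"
  shows "(\<lambda>(x, y). (1/2) *\<^sub>R (x + y)) \<in> (\<mu> \<Otimes>\<^sub>M \<mu>) \<rightarrow>\<^sub>M borel"
  by measurable

lemma prob_space_self_average:
  assumes "prob_space \<mu>" "sets \<mu> = sets borel"
  shows "prob_space (self_average \<mu>)"
proof -
  interpret prob_space \<mu> by fact
  interpret pair_prob_space \<mu> \<mu> ..
  show ?thesis
    unfolding self_average_def by (intro prob_space_distr measurable_average assms)
qed

lemma nn_integral_doubling_homothety:
  fixes h :: "'a::euclidean_space \<Rightarrow> ennreal"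
  assumes [measurable]: "h \<in> borel_measurable borel"
  shows "(\<integral>\<^sup>+y. h y \<partial>lborel) = 2 ^ DIM('a) * (\<integral>\<^sup>+z. h (2 *\<^sub>R z - x) \<partial>lborel)"
proof -
  have "lborel = density (distr lborel borel (\<lambda>z. - x + 2 *\<^sub>R z)) (\<lambda>_. ennreal (\<bar>2\<bar> ^ DIM('a)))"
    by (rule lborel_affine) simp
  from arg_cong[OF this, of "\<lambda>M. \<integral>\<^sup>+y. h y \<partial>M"] show ?thesis
    by (simp add: nn_integral_density nn_integral_distr nn_integral_cmult ennreal_power[symmetric])
qed

text \<open>
  A density at most \<open>D\<close> on \<open>K\<close> becomes a density at most \<open>D\<^sup>2\<close> times the density of the
  midpoint of two Lebesgue distributed points of \<open>K\<close>. The latter density at \<open>z\<close> is \<open>2\<^sup>d\<close> times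
  the volume of \<open>K \<inter> (2z - K)\<close>, since \<open>x\<close> and \<open>2z - x\<close> are the pairs with midpoint \<open>z\<close>; it
  vanishes off \<open>K\<close> by convexity. Densities are expressed through integrals of nonnegative test
  functions: in this form the hypothesis can be applied to one variable at a time, so that the
  product measure never has to be compared with Lebesgue measure on the product space.
\<close>

lemma nn_integral_self_average_le:
  fixes K :: "'a::euclidean_space set" and g :: "'a \<Rightarrow> ennreal"
  assumes \<mu>: "prob_space \<mu>" "sets \<mu> = sets borel"
    and K: "K \<in> sets borel" "convex K"
    and C: "\<And>z. emeasure lborel (K \<inter> (\<lambda>y. z - y) ` K) \<le> C"
    and dom: "\<And>g. g \<in> borel_measurable borel \<Longrightarrow>
      (\<integral>\<^sup>+x. g x \<partial>\<mu>) \<le> D * (\<integral>\<^sup>+x. g x * indicator K x \<partial>lborel)"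
    and g: "g \<in> borel_measurable borel"
  shows "(\<integral>\<^sup>+x. g x \<partial>self_average \<mu>)
    \<le> D\<^sup>2 * (2 ^ DIM('a) * C) * (\<integral>\<^sup>+x. g x * indicator K x \<partial>lborel)"
proof -
  interpret prob_space \<mu> by fact
  interpret pair_prob_space \<mu> \<mu> ..
  note [measurable_cong] = \<mu>(2)
  note [measurable] = g K(1)
  let ?m = "\<lambda>x y :: 'a. (1/2) *\<^sub>R (x + y)"
  have "(\<integral>\<^sup>+x. g x \<partial>self_average \<mu>) = (\<integral>\<^sup>+x. \<integral>\<^sup>+y. g (?m x y) \<partial>\<mu> \<partial>\<mu>)"
  proof -
    have "(\<integral>\<^sup>+x. g x \<partial>self_average \<mu>) = (\<integral>\<^sup>+z. g (case z of (x, y) \<Rightarrow> ?m x y) \<partial>(\<mu> \<Otimes>\<^sub>M \<mu>))"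
      unfolding self_average_def using \<mu>(2) g by (intro nn_integral_distr measurable_average) simp_all
    also have "\<dots> = (\<integral>\<^sup>+x. \<integral>\<^sup>+y. g (?m x y) \<partial>\<mu> \<partial>\<mu>)"
      by (subst sigma_finite_measure.nn_integral_fst[OF prob_space_imp_sigma_finite[OF \<mu>(1)], symmetric])
        simp_all
    finally show ?thesis .
  qed
  also have "\<dots> \<le> (\<integral>\<^sup>+x. D * (\<integral>\<^sup>+y. g (?m x y) * indicator K y \<partial>lborel) \<partial>\<mu>)"
    by (intro nn_integral_mono dom) simp
  also have "\<dots> \<le> D * (\<integral>\<^sup>+x. D * (\<integral>\<^sup>+y. g (?m x y) * indicator K y \<partial>lborel) * indicator K x \<partial>lborel)"
    by (intro dom) simp
  also have "\<dots> = D\<^sup>2 * (\<integral>\<^sup>+x. \<integral>\<^sup>+y. g (?m x y) * indicator K y * indicator K x \<partial>lborel \<partial>lborel)"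
    by (subst nn_integral_multc, simp, simp add: nn_integral_cmult mult.assoc power2_eq_square)
  also have "(\<integral>\<^sup>+x. \<integral>\<^sup>+y. g (?m x y) * indicator K y * indicator K x \<partial>lborel \<partial>lborel)
      = (\<integral>\<^sup>+x. 2 ^ DIM('a) * (\<integral>\<^sup>+z. g z * indicator K (2 *\<^sub>R z - x) * indicator K x \<partial>lborel) \<partial>lborel)"
  proof (intro nn_integral_cong)
    fix x :: 'a
    show "(\<integral>\<^sup>+y. g (?m x y) * indicator K y * indicator K x \<partial>lborel)
        = 2 ^ DIM('a) * (\<integral>\<^sup>+z. g z * indicator K (2 *\<^sub>R z - x) * indicator K x \<partial>lborel)"
      by (subst nn_integral_doubling_homothety[where x = x]) simp_all
  qed
  also have "\<dots> = 2 ^ DIM('a) * (\<integral>\<^sup>+z. \<integral>\<^sup>+x. g z * indicator K (2 *\<^sub>R z - x) * indicator K x \<partial>lborel \<partial>lborel)"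
    by (subst nn_integral_cmult, simp, subst lborel_pair.Fubini') simp_all
  also have "(\<integral>\<^sup>+z. \<integral>\<^sup>+x. g z * indicator K (2 *\<^sub>R z - x) * indicator K x \<partial>lborel \<partial>lborel)
      \<le> (\<integral>\<^sup>+z. C * (g z * indicator K z) \<partial>lborel)"
  proof (intro nn_integral_mono)
    fix z :: 'a
    let ?R = "K \<inter> (\<lambda>y. 2 *\<^sub>R z - y) ` K"
    have R: "x \<in> ?R \<longleftrightarrow> x \<in> K \<and> 2 *\<^sub>R z - x \<in> K" for x
      by (auto intro!: image_eqI[of _ _ "2 *\<^sub>R z - x"])
    have Req: "?R = {x \<in> space lborel. x \<in> K \<and> 2 *\<^sub>R z - x \<in> K}"
      using R by auto
    have [measurable]: "?R \<in> sets borel"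
      unfolding Req by measurable
    have "(\<integral>\<^sup>+x. g z * indicator K (2 *\<^sub>R z - x) * indicator K x \<partial>lborel)
        = (\<integral>\<^sup>+x. g z * indicator ?R x \<partial>lborel)"
      unfolding indicator_def R by (intro nn_integral_cong) auto
    also have "\<dots> = g z * emeasure lborel ?R"
      by (subst nn_integral_cmult_indicator) simp_all
    also have "\<dots> \<le> C * (g z * indicator K z)"
    proof (cases "z \<in> K")
      case True
      then show ?thesis
        using mult_left_mono[OF C[of "2 *\<^sub>R z"], of "g z"] by (simp add: mult.commute)
    next
      case False
      have "?R = {}"
      proof (rule ccontr)
        assume "?R \<noteq> {}"
        then obtain x where x: "x \<in> K" "2 *\<^sub>R z - x \<in> K" using R by blast
        have "(1/2) *\<^sub>R x + (1/2) *\<^sub>R (2 *\<^sub>R z - x) \<in> K"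
          by (rule convexD[OF K(2) x]) auto
        then show False using False by (simp add: algebra_simps)
      qed
      then show ?thesis by simp
    qed
    finally show "(\<integral>\<^sup>+x. g z * indicator K (2 *\<^sub>R z - x) * indicator K x \<partial>lborel)
        \<le> C * (g z * indicator K z)" .
  qed
  also have "\<dots> = C * (\<integral>\<^sup>+z. g z * indicator K z \<partial>lborel)"
    by (intro nn_integral_cmult) simp
  finally show ?thesis
    by (simp add: mult.assoc mult_left_mono)
qed

lemma integral_pair_product:
  fixes f :: "'a \<Rightarrow> real" and g :: "'b \<Rightarrow> real"
  assumes "sigma_finite_measure M" "sigma_finite_measure N"
    and f: "integrable M f" and g: "integrable N g"
  shows "integrable (M \<Otimes>\<^sub>M N) (\<lambda>(x, y). f x * g y)"
    and "(\<integral>z. (\<lambda>(x, y). f x * g y) z \<partial>(M \<Otimes>\<^sub>M N)) = (\<integral>x. f x \<partial>M) * (\<integral>y. g y \<partial>N)"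
proof -
  interpret pair_sigma_finite M N using assms(1,2) by (simp add: pair_sigma_finite_def)
  note [measurable] = borel_measurable_integrable[OF f] borel_measurable_integrable[OF g]
  show int: "integrable (M \<Otimes>\<^sub>M N) (\<lambda>(x, y). f x * g y)"
    by (rule Fubini_integrable) (simp_all add: abs_mult f g)
  show "(\<integral>z. (\<lambda>(x, y). f x * g y) z \<partial>(M \<Otimes>\<^sub>M N)) = (\<integral>x. f x \<partial>M) * (\<integral>y. g y \<partial>N)"
    using integral_fst[OF int] by simp
qed

text \<open>
  Variance is additive over independent variables and scales quadratically, so averaging two
  independent copies halves it. The cross term is the square of the mean, which is \<open>0\<close>.
\<close>

lemma self_average_moments:
  fixes f :: "'a::euclidean_space \<Rightarrow> real"
  assumes \<mu>: "prob_space \<mu>" "sets \<mu> = sets borel"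
    and f: "f \<in> borel_measurable borel" "\<And>x y. f ((1/2) *\<^sub>R (x + y)) = (f x + f y) / 2"
    and int: "integrable \<mu> f" "integrable \<mu> (\<lambda>x. (f x)\<^sup>2)"
    and mean: "(\<integral>x. f x \<partial>\<mu>) = 0"
  shows "integrable (self_average \<mu>) f" "integrable (self_average \<mu>) (\<lambda>x. (f x)\<^sup>2)"
    "(\<integral>x. f x \<partial>self_average \<mu>) = 0"
    "(\<integral>x. (f x)\<^sup>2 \<partial>self_average \<mu>) = (\<integral>x. (f x)\<^sup>2 \<partial>\<mu>) / 2"
proof -
  interpret prob_space \<mu> by fact
  note prod = integral_pair_product[OF sigma_finite_measure_axioms sigma_finite_measure_axioms, unfolded case_prod_beta]
  have one: "integrable \<mu> (\<lambda>_. 1 :: real)" by simp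
  note [measurable_cong] = \<mu>(2)
  note [measurable] = f(1)
  note p = prod[OF int(1) one, simplified] prod[OF one int(1), simplified]
    prod[OF int(2) one, simplified] prod[OF one int(2), simplified] prod[OF int(1) int(1)]
  have m: "(\<lambda>z. (1/2) *\<^sub>R (fst z + snd z)) \<in> \<mu> \<Otimes>\<^sub>M \<mu> \<rightarrow>\<^sub>M borel" by measurable
  have e1: "f ((1/2) *\<^sub>R (x + y)) = f x / 2 + f y / 2" for x y
    by (simp add: f(2) add_divide_distrib)
  have e2: "(f ((1/2) *\<^sub>R (x + y)))\<^sup>2
      = (f x)\<^sup>2 / 4 + (f y)\<^sup>2 / 4 + (f x * f y) / 2" for x y
    unfolding f(2) by (simp add: power2_eq_square field_simps)
  show "integrable (self_average \<mu>) f"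
    unfolding self_average_def case_prod_beta integrable_distr_eq[OF m f(1)] e1
    by (intro Bochner_Integration.integrable_add integrable_divide p)
  have f2: "(\<lambda>x. (f x)\<^sup>2) \<in> borel_measurable borel" by simp
  show "integrable (self_average \<mu>) (\<lambda>x. (f x)\<^sup>2)"
    unfolding self_average_def case_prod_beta integrable_distr_eq[OF m f2] e2
    by (intro Bochner_Integration.integrable_add integrable_divide p)
  show "(\<integral>x. f x \<partial>self_average \<mu>) = 0"
    unfolding self_average_def case_prod_beta integral_distr[OF m f(1)] e1
    using p mean by simp
  show "(\<integral>x. (f x)\<^sup>2 \<partial>self_average \<mu>) = (\<integral>x. (f x)\<^sup>2 \<partial>\<mu>) / 2"
    unfolding self_average_def case_prod_beta integral_distr[OF m f2] e2
    using p mean by (simp add: prob_space)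
qed

section \<open>Gaussian integrals and linear changes of variables\<close>

text \<open>
  Gram--Schmidt for the inner product \<open>u \<bullet> (B *v w)\<close>, by induction over finite sets \<open>S\<close> of
  coordinates. Instead of linear independence, the induction carries that the vectors built so far
  are supported in \<open>S\<close>: subtracting them from the next coordinate vector then cannot produce \<open>0\<close>.
\<close>

lemma orthonormalizing_matrix_exists:
  fixes B :: "real ^ 'n ^ 'n"
  assumes comm: "\<And>u w. u \<bullet> (B *v w) = w \<bullet> (B *v u)"
    and pos: "\<And>u. u \<noteq> 0 \<Longrightarrow> u \<bullet> (B *v u) > 0"
  obtains A :: "real ^ 'n ^ 'n" where "A ** B ** transpose A = mat 1"
proof -
  have "\<exists>v :: 'n \<Rightarrow> real ^ 'n. (\<forall>i\<in>S. \<forall>j\<in>S. v i \<bullet> (B *v v j) = of_bool (i = j)) \<and>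
      (\<forall>i\<in>S. \<forall>j. j \<notin> S \<longrightarrow> v i $ j = 0)" if "finite S" for S
    using that
  proof (induction S)
    case empty
    then show ?case by simp
  next
    case (insert a S)
    then obtain v :: "'n \<Rightarrow> real ^ 'n" where
      v: "\<And>i j. i \<in> S \<Longrightarrow> j \<in> S \<Longrightarrow> v i \<bullet> (B *v v j) = of_bool (i = j)"
      and supp: "\<And>i j. i \<in> S \<Longrightarrow> j \<notin> S \<Longrightarrow> v i $ j = 0"
      by blast
    define w where "w = axis a 1 - (\<Sum>j\<in>S. (v j \<bullet> (B *v axis a 1)) *\<^sub>R v j)"
    have wa: "w $ a = 1"
      using insert(2) by (simp add: w_def supp axis_def)
    have ws: "w $ j = 0" if "j \<notin> insert a S" for j
      using that by (simp add: w_def supp axis_def)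
    have orth: "v i \<bullet> (B *v w) = 0" if "i \<in> S" for i
    proof -
      have "v i \<bullet> (B *v w) = v i \<bullet> (B *v axis a 1)
          - (\<Sum>j\<in>S. (v j \<bullet> (B *v axis a 1)) * (v i \<bullet> (B *v v j)))"
        by (simp add: w_def matrix_vector_mult_diff_distrib linear_sum[OF matrix_vector_mul_linear]
            inner_diff_right inner_sum_right matrix_vector_mult_scaleR)
      also have "(\<Sum>j\<in>S. (v j \<bullet> (B *v axis a 1)) * (v i \<bullet> (B *v v j)))
          = (\<Sum>j\<in>S. if j = i then v j \<bullet> (B *v axis a 1) else 0)"
        using that by (intro sum.cong) (auto simp: v)
      finally show ?thesis using that insert(1) by simp
    qed
    have "w \<noteq> 0" using wa by auto
    then have r: "w \<bullet> (B *v w) > 0" by (rule pos)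
    define v' where "v' = v(a := (1 / sqrt (w \<bullet> (B *v w))) *\<^sub>R w)"
    have "v' i \<bullet> (B *v v' j) = of_bool (i = j)" if "i \<in> insert a S" "j \<in> insert a S" for i j
    proof -
      have "w \<bullet> (B *v v j) = 0" if "j \<in> S" for j
        using orth[OF that] comm by metis
      then show ?thesis
        using that insert(2) r v orth by (auto simp: v'_def matrix_vector_mult_scaleR)
    qed
    moreover have "v' i $ j = 0" if "i \<in> insert a S" "j \<notin> insert a S" for i j
      using that ws supp by (auto simp: v'_def)
    ultimately show ?case by (intro exI[of _ v']) blast
  qed
  from this[of UNIV] obtain v :: "'n \<Rightarrow> real ^ 'n"
    where v: "\<And>i j. v i \<bullet> (B *v v j) = of_bool (i = j)"
    by auto
  define A :: "real ^ 'n ^ 'n" where "A = (\<chi> i. v i)"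
  have "(A ** B ** transpose A) $ i $ j = v i \<bullet> (B *v v j)" for i j
    unfolding A_def matrix_matrix_mult_def matrix_vector_mult_def transpose_def inner_vec_def
    by (simp add: sum_distrib_left sum_distrib_right mult.assoc) (rule sum.swap)
  then have "A ** B ** transpose A = mat 1"
    by (simp add: vec_eq_iff v mat_def)
  then show thesis by (rule that)
qed

lemma nn_integral_gaussian:
  fixes t :: real
  assumes t: "t > 0"
  shows "(\<integral>\<^sup>+y. ennreal (exp (- t * y\<^sup>2 / 2)) \<partial>lborel) = ennreal (sqrt (2 * pi / t))"
proof -
  let ?s = "1 / sqrt t"
  have nd: "exp (- t * y\<^sup>2 / 2) = sqrt (2 * pi / t) * normal_density 0 ?s y" for y
    using t by (simp add: normal_density_def power_divide)
  have "(\<integral>\<^sup>+y. ennreal (exp (- t * y\<^sup>2 / 2)) \<partial>lborel)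
      = ennreal (sqrt (2 * pi / t)) * (\<integral>\<^sup>+y. ennreal (normal_density 0 ?s y) \<partial>lborel)"
    unfolding nd using t by (subst ennreal_mult) (auto simp: nn_integral_cmult)
  also have "(\<integral>\<^sup>+y. ennreal (normal_density 0 ?s y) \<partial>lborel) = 1"
    using t by (subst nn_integral_eq_integral) (auto simp: integrable_normal_density)
  finally show ?thesis by simp
qed

lemma nn_integral_gaussian_euclidean:
  fixes t :: real
  assumes t: "t > 0"
  shows "(\<integral>\<^sup>+x. ennreal (exp (- t * (norm x)\<^sup>2 / 2)) \<partial>(lborel :: 'a::euclidean_space measure))
    = ennreal (sqrt (2 * pi / t) ^ DIM('a))"
proof -
  have "ennreal (exp (- t * (norm x)\<^sup>2 / 2)) = (\<Prod>b\<in>Basis. ennreal (exp (- t * (x \<bullet> b)\<^sup>2 / 2)))"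
    for x :: 'a
  proof -
    have "(norm x)\<^sup>2 = (\<Sum>b\<in>Basis. (x \<bullet> b)\<^sup>2)"
      by (subst power2_norm_eq_inner, subst euclidean_inner) (simp add: power2_eq_square)
    then have "exp (- t * (norm x)\<^sup>2 / 2) = exp (\<Sum>b\<in>Basis. - t * (x \<bullet> b)\<^sup>2 / 2)"
      by (simp add: sum_distrib_left sum_divide_distrib sum_negf)
    then show ?thesis by (simp add: exp_sum prod_ennreal)
  qed
  then have "(\<integral>\<^sup>+x. ennreal (exp (- t * (norm x)\<^sup>2 / 2)) \<partial>(lborel :: 'a measure))
      = (\<Prod>b\<in>(Basis :: 'a set). \<integral>\<^sup>+y. ennreal (exp (- t * y\<^sup>2 / 2)) \<partial>lborel)"
    by (simp only:) (subst nn_integral_lborel_prod, simp_all)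
  also have "\<dots> = ennreal (sqrt (2 * pi / t) ^ DIM('a))"
    using t by (subst nn_integral_gaussian) (simp_all add: ennreal_power)
  finally show ?thesis .
qed

text \<open>
  Measures are compared on boxes, and the preimage of a box under \<open>T\<close> is in general not a box.
  A linear map that preserves the volume of boxes, however, preserves that of every bounded open
  set, and the preimage is one.
\<close>

lemma lborel_distr_eqI:
  fixes T :: "'a::euclidean_space \<Rightarrow> 'a"
  assumes T: "linear T" "bij T" and cbox: "\<And>a b. measure lebesgue (T ` cbox a b) = measure lebesgue (cbox a b)"
  shows "distr lborel borel T = lborel"
proof (rule lborel_eqI[symmetric])
  fix l u :: 'a
  assume le: "\<And>b. b \<in> Basis \<Longrightarrow> l \<bullet> b \<le> u \<bullet> b"
  have [measurable]: "T \<in> borel \<rightarrow>\<^sub>M borel"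
    by (intro borel_measurable_continuous_onI linear_continuous_on linear_conv_bounded_linear[THEN iffD1] T)
  let ?S = "T -` box l u"
  have "linear (inv T)" using T by (simp add: bij_is_inj inj_linear_imp_inv_linear)
  then have "bounded (inv T ` box l u)"
    by (intro bounded_linear_image) (simp_all add: linear_conv_bounded_linear)
  then have "bounded ?S" using T(2) by (simp add: bij_vimage_eq_inv_image)
  moreover have "open ?S"
    by (intro continuous_open_vimage open_box linear_continuous_at) (use T in \<open>simp add: linear_conv_bounded_linear\<close>)
  ultimately have S: "?S \<in> lmeasurable" by (rule lmeasurable_open)
  have "emeasure lborel ?S = ennreal (measure lebesgue ?S)"
    using emeasure_eq_ennreal_measure[OF fmeasurableD2[OF S]] \<open>open ?S\<close> by simp
  also have "measure lebesgue ?S = measure lebesgue (T ` ?S)"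
    using measure_linear_sufficient[OF T(1) S, of 1] cbox by simp
  also have "T ` ?S = box l u" using T(2) by (simp add: bij_is_surj)
  also have "ennreal (measure lebesgue (box l u)) = (\<Prod>b\<in>Basis. (u - l) \<bullet> b)"
    using le by (simp add: measure_lborel_box_eq)
  finally show "emeasure (distr lborel borel T) (box l u) = (\<Prod>b\<in>Basis. (u - l) \<bullet> b)"
    by (simp add: emeasure_distr)
qed simp

lemma bij_matrix_vector_mult:
  fixes A :: "real ^ 'n ^ 'n"
  assumes "det A \<noteq> 0"
  shows "bij ((*v) A)"
  by (metis assms bij_betw_def invertible_def invertible_det_nz matrix_left_invertible_injective
      matrix_right_invertible_surjective)

text \<open>
  The change of variables formula for linear maps, on \<open>real ^ 'n\<close> for an index type that carries no
  order. The determinant and the dilation factor are both multiplicative, so it suffices to treat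
  the elementary matrices: diagonal ones scale the coordinates, and swaps and shears preserve the
  volume of every box.
\<close>

lemma nn_integral_linear_image:
  fixes A :: "real ^ 'n ^ 'n" and g :: "real ^ 'n \<Rightarrow> ennreal"
  assumes "det A \<noteq> 0" "g \<in> borel_measurable borel"
  shows "(\<integral>\<^sup>+x. g x \<partial>lborel) = ennreal \<bar>det A\<bar> * (\<integral>\<^sup>+x. g (A *v x) \<partial>lborel)"
proof -
  have meas: "(*v) A \<in> borel \<rightarrow>\<^sub>M borel" for A :: "real ^ 'n ^ 'n"
    by (intro borel_measurable_continuous_onI matrix_vector_mult_linear_continuous_on)
  have unimodular: "(\<integral>\<^sup>+x. g x \<partial>lborel) = ennreal \<bar>det A\<bar> * (\<integral>\<^sup>+x. g (A *v x) \<partial>lborel)"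
    if "\<bar>det A\<bar> = 1" "\<And>a b. measure lebesgue ((*v) A ` cbox a b) = measure lebesgue (cbox a b)"
      "g \<in> borel_measurable borel"
    for A :: "real ^ 'n ^ 'n" and g :: "real ^ 'n \<Rightarrow> ennreal"
  proof -
    have "distr lborel borel ((*v) A) = lborel"
      using that by (intro lborel_distr_eqI matrix_vector_mul_linear bij_matrix_vector_mult) auto
    then have "(\<integral>\<^sup>+x. g x \<partial>lborel) = (\<integral>\<^sup>+x. g x \<partial>distr lborel borel ((*v) A))" by simp
    then show ?thesis using that(1,3) meas by (simp add: nn_integral_distr)
  qed
  have "\<forall>g\<in>borel_measurable borel. det A \<noteq> 0 \<longrightarrow>
      (\<integral>\<^sup>+x. g x \<partial>lborel) = ennreal \<bar>det A\<bar> * (\<integral>\<^sup>+x. g (A *v x) \<partial>lborel)"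
  proof (induct A rule: induct_matrix_elementary_alt, goal_cases mult zero_row diagonal swap1 idplus)
    case (mult A B)
    show ?case
    proof (intro ballI impI)
      fix g :: "real ^ 'n \<Rightarrow> ennreal"
      assume [measurable]: "g \<in> borel_measurable borel" and "det (A ** B) \<noteq> 0"
      then have d: "det A \<noteq> 0" "det B \<noteq> 0" by (auto simp: det_mul)
      note [measurable] = meas
      have gA: "(\<lambda>x. g (A *v x)) \<in> borel_measurable borel" by measurable
      have "(\<integral>\<^sup>+x. g x \<partial>lborel) = ennreal \<bar>det A\<bar> * (\<integral>\<^sup>+x. g (A *v x) \<partial>lborel)"
        by (rule mult(1)[rule_format, OF _ d(1)]) simp
      also have "(\<integral>\<^sup>+x. g (A *v x) \<partial>lborel) = ennreal \<bar>det B\<bar> * (\<integral>\<^sup>+x. g (A *v (B *v x)) \<partial>lborel)"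
        using mult(2)[rule_format, OF gA d(2)] .
      finally show "(\<integral>\<^sup>+x. g x \<partial>lborel) = ennreal \<bar>det (A ** B)\<bar> * (\<integral>\<^sup>+x. g ((A ** B) *v x) \<partial>lborel)"
        by (simp add: det_mul abs_mult ennreal_mult mult.assoc matrix_vector_mul_assoc)
    qed
  next
    case (zero_row A i)
    then show ?case using det_zero_row(2) by blast
  next
    case (diagonal A)
    define c where "c b = b \<bullet> (A *v b)" for b :: "real ^ 'n"
    have cA: "A *v axis i 1 = (A $ i $ i) *\<^sub>R axis i 1" for i
    proof -
      have "(A *v axis i 1) $ k = ((A $ i $ i) *\<^sub>R axis i 1) $ k" for k
        unfolding matrix_vector_mult_basis
        using diagonal[of k i] by (cases "k = i") (auto simp: column_def axis_def)
      then show ?thesis by (simp only: vec_eq_iff) blast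
    qed
    then have c: "c (axis i 1) = A $ i $ i" for i
      by (simp add: c_def)
    have Basis: "Basis = range (\<lambda>i. axis i (1 :: real) :: real ^ 'n)"
      by (auto simp: Basis_vec_def)
    have inj: "inj (\<lambda>i. axis i (1 :: real) :: real ^ 'n)"
      by (auto simp: inj_def axis_eq_axis)
    have det: "\<bar>det A\<bar> = (\<Prod>b\<in>Basis. \<bar>c b\<bar>)"
      by (simp add: det_diagonal[OF diagonal] Basis prod.reindex[OF inj] c abs_prod)
    have T: "A *v x = 0 + (\<Sum>b\<in>Basis. (c b * (x \<bullet> b)) *\<^sub>R b)" for x
    proof -
      have "A *v x = A *v (\<Sum>b\<in>Basis. (x \<bullet> b) *\<^sub>R b)" by (simp add: euclidean_representation)
      also have "\<dots> = (\<Sum>b\<in>Basis. (x \<bullet> b) *\<^sub>R (A *v b))"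
        by (simp add: linear_sum[OF matrix_vector_mul_linear] matrix_vector_mult_scaleR)
      also have "\<dots> = (\<Sum>b\<in>Basis. (c b * (x \<bullet> b)) *\<^sub>R b)"
        by (intro sum.cong) (auto simp: Basis cA c)
      finally show ?thesis by simp
    qed
    show ?case
    proof (intro ballI impI)
      fix g :: "real ^ 'n \<Rightarrow> ennreal"
      assume g: "g \<in> borel_measurable borel" and "det A \<noteq> 0"
      then have "c b \<noteq> 0" if "b \<in> Basis" for b
        using that det prod_zero[of Basis "\<lambda>b. \<bar>c b\<bar>"] by fastforce
      then have "lborel = density (distr lborel borel ((*v) A)) (\<lambda>_. ennreal \<bar>det A\<bar>)"
        unfolding det T by (rule lborel_affine_euclidean)
      from arg_cong[OF this, of "\<lambda>M. \<integral>\<^sup>+x. g x \<partial>M"]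
      show "(\<integral>\<^sup>+x. g x \<partial>lborel) = ennreal \<bar>det A\<bar> * (\<integral>\<^sup>+x. g (A *v x) \<partial>lborel)"
        using g meas[of A] by (simp add: nn_integral_density nn_integral_distr nn_integral_cmult)
    qed
  next
    case (swap1 m n)
    let ?A = "\<chi> i j. mat 1 $ i $ Transposition.transpose m n j :: real ^ 'n ^ 'n"
    have p: "Transposition.transpose m n permutes UNIV" by (simp add: permutes_swap_id)
    have det: "\<bar>det ?A\<bar> = 1"
      by (simp add: det_permute_columns[OF p] sign_swap_id abs_mult)
    have A: "?A *v x = (\<chi> i. x $ Transposition.transpose m n i)" for x :: "real ^ 'n"
    proof -
      have "(?A *v x) $ i = (\<Sum>j\<in>UNIV. if j = Transposition.transpose m n i then x $ j else 0)" for i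
        unfolding matrix_vector_mult_def mat_def vec_lambda_beta
        by (intro sum.cong refl) (metis mult_1 mult_zero_left transpose_involutory)
      then show ?thesis by (simp add: vec_eq_iff)
    qed
    have "measure lebesgue ((*v) ?A ` cbox a b) = measure lebesgue (cbox a b)" for a b
    proof (cases "cbox a b = {}")
      case False
      have invol: "?A *v (?A *v y) = y" for y unfolding A by (simp add: vec_eq_iff)
      have sub: "(*v) ?A ` cbox a b \<subseteq> cbox (?A *v a) (?A *v b)" for a b
        unfolding A image_subset_iff mem_box_cart vec_lambda_beta by (simp add: mem_box_cart)
      have eq: "(*v) ?A ` cbox a b = cbox (?A *v a) (?A *v b)"
      proof (rule equalityI[OF sub])
        have "y \<in> (*v) ?A ` cbox a b" if "y \<in> cbox (?A *v a) (?A *v b)" for y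
        proof (rule image_eqI[of y "(*v) ?A" "?A *v y", OF invol[symmetric]])
          show "?A *v y \<in> cbox a b"
            using sub[of "?A *v a" "?A *v b"] that unfolding invol by blast
        qed
        then show "cbox (?A *v a) (?A *v b) \<subseteq> (*v) ?A ` cbox a b" by blast
      qed
      then have ne: "cbox (?A *v a) (?A *v b) \<noteq> {}" using False by blast
      have "measure lebesgue ((*v) ?A ` cbox a b) = (\<Prod>i\<in>UNIV. (?A *v b) $ i - (?A *v a) $ i)"
        unfolding eq using content_cbox_cart[OF ne] by simp
      also have "\<dots> = (\<Prod>i\<in>UNIV. b $ i - a $ i)"
        unfolding A vec_lambda_beta
        using prod.permute[OF p, of "\<lambda>i. b $ i - a $ i"] by (simp add: o_def)
      also have "\<dots> = measure lebesgue (cbox a b)"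
        using content_cbox_cart[OF False] by simp
      finally show ?thesis .
    qed simp
    then show ?case using unimodular[OF det] by blast
  next
    case (idplus m n)
    let ?A = "\<chi> i j. of_bool (i = m \<and> j = n \<or> i = j) :: real ^ 'n ^ 'n"
    have "?A = (\<chi> k. if k = m then row m (mat 1) + 1 *s row n (mat 1) else row k (mat 1))"
      using idplus by (auto simp: vec_eq_iff row_def mat_def)
    then have det: "\<bar>det ?A\<bar> = 1"
      by (simp add: det_row_operation[OF idplus])
    have A: "?A *v x = (\<chi> i. if i = m then x $ m + x $ n else x $ i)" for x :: "real ^ 'n"
    proof -
      have "(?A *v x) $ i = (\<Sum>j\<in>UNIV. (if j = i then x $ j else 0) + (if j = n then of_bool (i = m) * x $ j else 0))" for i
        unfolding matrix_vector_mult_def vec_lambda_beta using idplus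
        by (intro sum.cong refl) auto
      then show ?thesis by (simp add: vec_eq_iff sum.distrib)
    qed
    have "measure lebesgue ((*v) ?A ` cbox a b) = measure lebesgue (cbox a b)" for a b
    proof (cases "cbox a b = {}")
      case False
      \<comment> \<open>The volume of a sheared box is known when its corner has a nonnegative \<open>n\<close>-th coordinate,
        so the box is first moved to the origin.\<close>
      have t: "cbox a b = (+) a ` cbox 0 (b - a)"
        by (simp add: cbox_translation[symmetric])
      have "(*v) ?A ` cbox a b = (+) (?A *v a) ` (*v) ?A ` cbox 0 (b - a)"
        unfolding t image_image by (simp add: matrix_vector_right_distrib)
      then have "measure lebesgue ((*v) ?A ` cbox a b) = measure lebesgue ((*v) ?A ` cbox 0 (b - a))"
        by (simp add: measure_translation)
      also have "\<dots> = measure lebesgue (cbox 0 (b - a))"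
        unfolding A using idplus False t by (intro measure_shear_interval) auto
      also have "\<dots> = measure lebesgue (cbox a b)"
        unfolding t by (simp only: measure_translation)
      finally show ?thesis .
    qed simp
    then show ?case using unimodular[OF det] by blast
  qed
  then show ?thesis using assms by blast
qed

section \<open>Uniform distribution and covariance of a convex body\<close>

lemma convex_body_vol_pos:
  assumes "convex_body K"
  shows "vol K > 0"
proof -
  have "\<not> negligible K"
    using assms by (simp add: convex_body_def negligible_convex_interior)
  then show ?thesis
    using assms lmeasurable_compact[of K] measure_nonneg[of lebesgue K]
    by (auto simp: convex_body_def negligible_iff_measure less_le)
qed

text \<open>
  The uniform distribution, restricted to the Borel sets, where product measures and images behave
  better than on the completed Lebesgue \<open>\<sigma>\<close>-algebra.
\<close>

definition uniform_on :: "'a::euclidean_space set \<Rightarrow> 'a measure" where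
  "uniform_on K = distr (uniform_measure lebesgue K) borel (\<lambda>x. x)"

lemma sets_uniform_on [simp, measurable_cong]: "sets (uniform_on K) = sets borel"
  by (simp add: uniform_on_def)

lemma measurable_uniform_lebesgue:
  "(\<lambda>x. x) \<in> uniform_measure lebesgue (K :: 'a::euclidean_space set) \<rightarrow>\<^sub>M borel"
  by (simp add: measurable_def)

lemma nn_integral_uniform_on:
  fixes K :: "(real ^ 'd) set"
  assumes K: "convex_body K" and g: "g \<in> borel_measurable borel"
  shows "(\<integral>\<^sup>+x. g x \<partial>uniform_on K) = ennreal (1 / vol K) * (\<integral>\<^sup>+x. g x * indicator K x \<partial>lborel)"
proof -
  have [measurable]: "K \<in> sets borel" using K by (simp add: convex_body_def compact_imp_closed)
  have Km: "K \<in> lmeasurable" using K by (simp add: convex_body_def lmeasurable_compact)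
  have "(\<integral>\<^sup>+x. g x \<partial>uniform_on K) = (\<integral>\<^sup>+x. g x \<partial>uniform_measure lebesgue K)"
    unfolding uniform_on_def using g measurable_uniform_lebesgue by (subst nn_integral_distr) auto
  also have "\<dots> = (\<integral>\<^sup>+x. g x * indicator K x \<partial>lebesgue) / emeasure lebesgue K"
    using g Km by (intro nn_integral_uniform_measure) (auto intro: measurable_completion)
  also have "emeasure lebesgue K = ennreal (vol K)"
    using Km by (simp add: emeasure_eq_measure2)
  finally show ?thesis
    using convex_body_vol_pos[OF K]
    by (simp add: nn_integral_completion divide_ennreal_def inverse_ennreal inverse_eq_divide mult.commute)
qed

lemma prob_space_uniform_on:
  fixes K :: "(real ^ 'd) set"
  assumes K: "convex_body K"
  shows "prob_space (uniform_on K)"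
proof
  have Km: "K \<in> lmeasurable" using K by (simp add: convex_body_def lmeasurable_compact)
  have b: "K \<in> sets borel" using K by (simp add: convex_body_def compact_imp_closed)
  have "emeasure (uniform_on K) (space (uniform_on K)) = (\<integral>\<^sup>+x. 1 \<partial>uniform_on K)"
    by simp
  also have "\<dots> = ennreal (1 / vol K) * emeasure lborel K"
    using b by (subst nn_integral_uniform_on[OF K]) simp_all
  also have "emeasure lborel K = ennreal (vol K)"
    using emeasure_eq_ennreal_measure[OF fmeasurableD2[OF Km]] b by simp
  also have "ennreal (1 / vol K) * ennreal (vol K) = 1"
    using convex_body_vol_pos[OF K] by (simp add: ennreal_mult[symmetric])
  finally show "emeasure (uniform_on K) (space (uniform_on K)) = 1" .
qed

lemma AE_uniform_on:
  fixes K :: "(real ^ 'd) set"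
  assumes K: "convex_body K" and [measurable]: "Measurable.pred borel P"
  shows "(AE x in uniform_on K. P x) \<longleftrightarrow> (AE x in lborel. x \<in> K \<longrightarrow> P x)"
proof -
  have [measurable]: "K \<in> sets borel" using K by (simp add: convex_body_def compact_imp_closed)
  have "(AE x in uniform_on K. P x) \<longleftrightarrow> (\<integral>\<^sup>+x. indicator {x. \<not> P x} x \<partial>uniform_on K) = 0"
    by (subst nn_integral_0_iff_AE) (auto simp: indicator_def)
  also have "\<dots> \<longleftrightarrow> (\<integral>\<^sup>+x. indicator {x. \<not> P x} x * indicator K x \<partial>lborel) = 0"
    using convex_body_vol_pos[OF K] by (subst nn_integral_uniform_on[OF K]) auto
  also have "\<dots> \<longleftrightarrow> (AE x in lborel. x \<in> K \<longrightarrow> P x)"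
    by (subst nn_integral_0_iff_AE) (auto simp: indicator_def)
  finally show ?thesis .
qed

lemma integrable_uniform_on:
  fixes K :: "(real ^ 'd) set" and f :: "real ^ 'd \<Rightarrow> 'b::{banach, second_countable_topology}"
  assumes K: "convex_body K" and f: "continuous_on UNIV f"
  shows "integrable (uniform_on K) f"
proof -
  interpret prob_space "uniform_on K" by (rule prob_space_uniform_on[OF K])
  have [measurable]: "f \<in> borel_measurable borel" using f by (rule borel_measurable_continuous_onI)
  have "compact (f ` K)"
    using K f by (intro compact_continuous_image) (auto simp: convex_body_def intro: continuous_on_subset)
  then obtain B where "\<And>x. x \<in> K \<Longrightarrow> norm (f x) \<le> B"
    using compact_imp_bounded bounded_iff by (metis imageI)
  then have "AE x in uniform_on K. norm (f x) \<le> B"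
    by (subst AE_uniform_on[OF K]) auto
  then show ?thesis by (rule integrable_const_bound) simp
qed

lemma integral_uniform_measure_eq:
  fixes f :: "real ^ 'd \<Rightarrow> 'b::{banach, second_countable_topology}"
  assumes "continuous_on UNIV f"
  shows "(LINT x|uniform_measure lebesgue K. f x) = (LINT x|uniform_on K. f x)"
  unfolding uniform_on_def
  by (rule integral_distr[symmetric, OF measurable_uniform_lebesgue])
    (rule borel_measurable_continuous_onI[OF assms])

lemma mean_uniform_on:
  fixes K :: "(real ^ 'd) set"
  assumes K: "convex_body K"
  shows "(LINT x|uniform_on K. u \<bullet> (x - barycenter K)) = 0"
proof -
  interpret prob_space "uniform_on K" by (rule prob_space_uniform_on[OF K])
  have int: "integrable (uniform_on K) (\<lambda>x. x)"
    by (intro integrable_uniform_on K continuous_intros)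
  have "barycenter K = (LINT x|uniform_on K. x)"
    unfolding barycenter_def by (intro integral_uniform_measure_eq continuous_intros)
  then show ?thesis
    using int by (simp add: inner_diff_right prob_space)
qed

lemma inner_covariance_matrix:
  fixes K :: "(real ^ 'd) set"
  assumes K: "convex_body K"
  shows "u \<bullet> (covariance_matrix K *v w)
    = (LINT x|uniform_on K. (u \<bullet> (x - barycenter K)) * (w \<bullet> (x - barycenter K)))"
proof -
  let ?b = "barycenter K"
  have c: "continuous_on UNIV (\<lambda>x. outer_product (x - ?b) (x - ?b))"
    unfolding outer_product_def by (intro continuous_intros)
  have op: "outer_product y y *v w = (w \<bullet> y) *\<^sub>R y" for y
    by (simp add: vec_eq_iff outer_product_def matrix_vector_mult_def inner_vec_def sum_distrib_left
        sum_distrib_right mult_ac)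
  have "bounded_linear (\<lambda>M :: real ^ 'd ^ 'd. u \<bullet> (M *v w))"
    by (intro linear_conv_bounded_linear[THEN iffD1] linearI)
      (simp_all add: matrix_vector_mult_add_rdistrib inner_add_right scaleR_matrix_vector_assoc[symmetric])
  from integral_bounded_linear[OF this integrable_uniform_on[OF K c]]
  have "u \<bullet> (covariance_matrix K *v w)
      = (LINT x|uniform_on K. u \<bullet> (outer_product (x - ?b) (x - ?b) *v w))"
    unfolding covariance_matrix_def by (simp add: integral_uniform_measure_eq[OF c])
  also have "(\<lambda>x. u \<bullet> (outer_product (x - ?b) (x - ?b) *v w)) = (\<lambda>x. (u \<bullet> (x - ?b)) * (w \<bullet> (x - ?b)))"
    by (simp add: op mult.commute)
  finally show ?thesis .
qed

text \<open>
  A variance \<open>0\<close> in direction \<open>u\<close> would confine \<open>K\<close> to a hyperplane up to a null set, which is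
  impossible as \<open>K\<close> has positive volume.
\<close>

lemma covariance_matrix_pos:
  fixes K :: "(real ^ 'd) set"
  assumes K: "convex_body K" and u: "u \<noteq> 0"
  shows "u \<bullet> (covariance_matrix K *v u) > 0"
proof -
  let ?f = "\<lambda>x. (u \<bullet> (x - barycenter K)) * (u \<bullet> (x - barycenter K))"
  have int: "integrable (uniform_on K) ?f"
    by (intro integrable_uniform_on K continuous_intros)
  have "(LINT x|uniform_on K. ?f x) \<noteq> 0"
  proof
    assume "(LINT x|uniform_on K. ?f x) = 0"
    then have "AE x in uniform_on K. ?f x = 0"
      by (subst (asm) integral_nonneg_eq_0_iff_AE[OF int]) auto
    then have f0: "AE x in lborel. x \<in> K \<longrightarrow> ?f x = 0"
      by (subst (asm) AE_uniform_on[OF K]) auto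
    have "negligible {x. u \<bullet> x = u \<bullet> barycenter K}"
      using u by (intro negligible_hyperplane) auto
    then have "AE x in lebesgue. x \<notin> {x. u \<bullet> x = u \<bullet> barycenter K}"
      by (intro AE_not_in) (simp add: negligible_iff_null_sets)
    with AE_completion[OF f0] have "AE x in lebesgue. x \<notin> K"
      by eventually_elim (auto simp: inner_diff_right)
    moreover have "K \<in> sets lebesgue"
      using K by (simp add: convex_body_def compact_imp_closed)
    ultimately have "vol K = 0"
      using AE_iff_null_sets[of K lebesgue] by (auto simp: measure_def null_sets_def)
    then show False using convex_body_vol_pos[OF K] by simp
  qed
  then show ?thesis
    unfolding inner_covariance_matrix[OF K] by (simp add: less_le)
qed

text \<open>
  In the coordinates \<open>A *v x\<close> the body is in isotropic position up to scaling. Working with \<open>A\<close>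
  directly avoids transforming \<open>K\<close>, its symmetric intersections and its covariance matrix.
\<close>

lemma covariance_whitening:
  fixes K :: "(real ^ 'd) set"
  assumes K: "convex_body K"
  obtains A :: "real ^ 'd ^ 'd"
  where "A ** covariance_matrix K ** transpose A = mat 1" "det A \<noteq> 0" "det (covariance_matrix K) > 0"
    "1 / \<bar>det A\<bar> = sqrt (det (covariance_matrix K))"
proof -
  let ?\<Sigma> = "covariance_matrix K"
  have comm: "u \<bullet> (?\<Sigma> *v w) = w \<bullet> (?\<Sigma> *v u)" for u w
    by (simp add: inner_covariance_matrix[OF K] mult.commute)
  obtain A :: "real ^ 'd ^ 'd" where A: "A ** ?\<Sigma> ** transpose A = mat 1"
    using orthonormalizing_matrix_exists[OF comm covariance_matrix_pos[OF K]] .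
  have "det (A ** ?\<Sigma> ** transpose A) = 1" using A by simp
  then have det: "(det A)\<^sup>2 * det ?\<Sigma> = 1"
    by (simp add: det_mul power2_eq_square mult_ac)
  then have dA: "det A \<noteq> 0" by auto
  then have "(det A)\<^sup>2 > 0" by simp
  with det have dS: "det ?\<Sigma> > 0" by (metis zero_less_mult_pos zero_less_one)
  have "sqrt ((det A)\<^sup>2 * det ?\<Sigma>) = 1" using det by simp
  then have "1 / \<bar>det A\<bar> = sqrt (det ?\<Sigma>)"
    using dA by (simp add: real_sqrt_mult field_simps)
  with A dA dS show thesis by (rule that)
qed

section \<open>Averages of many independent points\<close>

text \<open>
  The bound on the density obeys the recursion \<open>D \<mapsto> D\<^sup>2 * (2\<^sup>d * C)\<close>, where \<open>d\<close> is the
  dimension. The initial bound enters once for each of the \<open>2\<^sup>k\<close> points averaged, and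
  \<open>2\<^sup>d * C\<close> once for each midpoint taken, that is, for each of the \<open>2\<^sup>k - 1\<close> inner nodes of a
  complete binary tree with \<open>2\<^sup>k\<close> leaves.
\<close>

lemma funpow_self_average_bound:
  fixes K :: "'a::euclidean_space set" and \<mu> :: "'a measure" and C D :: real
  assumes \<mu>: "prob_space \<mu>" "sets \<mu> = sets borel"
    and K: "K \<in> sets borel" "convex K"
    and C: "C \<ge> 0" "\<And>z. emeasure lborel (K \<inter> (\<lambda>y. z - y) ` K) \<le> ennreal C"
    and D: "D \<ge> 0" "\<And>g. g \<in> borel_measurable borel \<Longrightarrow>
      (\<integral>\<^sup>+x. g x \<partial>\<mu>) \<le> ennreal D * (\<integral>\<^sup>+x. g x * indicator K x \<partial>lborel)"
  shows "prob_space ((self_average ^^ k) \<mu>) \<and> sets ((self_average ^^ k) \<mu>) = sets borel \<and>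
    (\<forall>g\<in>borel_measurable borel. (\<integral>\<^sup>+x. g x \<partial>(self_average ^^ k) \<mu>)
      \<le> ennreal (D ^ 2 ^ k * (2 ^ DIM('a) * C) ^ (2 ^ k - 1)) * (\<integral>\<^sup>+x. g x * indicator K x \<partial>lborel))"
proof (induction k)
  case 0
  then show ?case using \<mu> D by simp
next
  case (Suc k)
  let ?\<mu> = "(self_average ^^ k) \<mu>"
  let ?D = "D ^ 2 ^ k * (2 ^ DIM('a) * C) ^ (2 ^ k - 1)"
  have p: "prob_space ?\<mu>" "sets ?\<mu> = sets borel" using Suc by auto
  have "(2 :: nat) ^ k \<ge> 1" by simp
  then have ex: "2 ^ Suc k - 1 = (2 ^ k - 1) * 2 + (1 :: nat)"
    unfolding power_Suc by linarith
  have pow: "(D ^ m * Q ^ j)\<^sup>2 * Q = D ^ (2 * m) * Q ^ (j * 2 + 1)" for m j and Q :: real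
    by (simp add: power_mult_distrib power_even_eq mult.commute[of j 2])
  have D2: "(ennreal ?D)\<^sup>2 * (2 ^ DIM('a) * ennreal C)
      = ennreal (D ^ 2 ^ Suc k * (2 ^ DIM('a) * C) ^ (2 ^ Suc k - 1))"
  proof -
    have "(ennreal ?D)\<^sup>2 * (2 ^ DIM('a) * ennreal C) = ennreal ((?D)\<^sup>2 * (2 ^ DIM('a) * C))"
      using C D by (simp add: ennreal_mult ennreal_power[symmetric])
    also have "(?D)\<^sup>2 * (2 ^ DIM('a) * C) = D ^ 2 ^ Suc k * (2 ^ DIM('a) * C) ^ (2 ^ Suc k - 1)"
      using pow[of "2 ^ k" "2 ^ DIM('a) * C" "2 ^ k - 1"] unfolding ex unfolding power_Suc .
    finally show ?thesis .
  qed
  show ?case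
    unfolding funpow.simps o_def D2[symmetric]
    using nn_integral_self_average_le[OF p K C(2)] Suc prob_space_self_average[OF p] by auto
qed

lemma funpow_self_average_moments:
  fixes f :: "'a::euclidean_space \<Rightarrow> real"
  assumes \<mu>: "prob_space \<mu>" "sets \<mu> = sets borel"
    and f: "f \<in> borel_measurable borel" "\<And>x y. f ((1/2) *\<^sub>R (x + y)) = (f x + f y) / 2"
    and int: "integrable \<mu> f" "integrable \<mu> (\<lambda>x. (f x)\<^sup>2)"
    and mean: "(\<integral>x. f x \<partial>\<mu>) = 0"
  shows "integrable ((self_average ^^ k) \<mu>) (\<lambda>x. (f x)\<^sup>2) \<and>
    (\<integral>x. (f x)\<^sup>2 \<partial>(self_average ^^ k) \<mu>) = (\<integral>x. (f x)\<^sup>2 \<partial>\<mu>) / 2 ^ k"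
proof -
  let ?\<mu> = "\<lambda>k. (self_average ^^ k) \<mu>"
  have "prob_space (?\<mu> k) \<and> sets (?\<mu> k) = sets borel \<and> integrable (?\<mu> k) f \<and>
      integrable (?\<mu> k) (\<lambda>x. (f x)\<^sup>2) \<and> (\<integral>x. f x \<partial>?\<mu> k) = 0 \<and>
      (\<integral>x. (f x)\<^sup>2 \<partial>?\<mu> k) = (\<integral>x. (f x)\<^sup>2 \<partial>\<mu>) / 2 ^ k"
  proof (induction k)
    case 0
    then show ?case using assms by simp
  next
    case (Suc k)
    then show ?case
      using prob_space_self_average[of "?\<mu> k"] self_average_moments[of "?\<mu> k" f] f by simp
  qed
  then show ?thesis by blast
qed

lemma nn_integral_gaussian_affine:
  fixes A :: "real ^ 'd ^ 'd" and t :: real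
  assumes t: "t > 0" and A: "det A \<noteq> 0"
  shows "(\<integral>\<^sup>+x. ennreal (exp (- t * (norm (A *v (x - b)))\<^sup>2 / 2)) \<partial>lborel)
    = ennreal (sqrt (2 * pi / t) ^ CARD('d) / \<bar>det A\<bar>)"
proof -
  let ?h = "\<lambda>y :: real ^ 'd. ennreal (exp (- t * (norm y)\<^sup>2 / 2))"
  have [measurable]: "(*v) A \<in> borel \<rightarrow>\<^sub>M borel"
    by (intro borel_measurable_continuous_onI matrix_vector_mult_linear_continuous_on)
  have "(\<integral>\<^sup>+x. ?h (A *v (x - b)) \<partial>lborel) = (\<integral>\<^sup>+x. ?h (A *v (x - b)) \<partial>distr lborel borel ((+) b))"
    by (simp add: lborel_distr_plus)
  also have "\<dots> = (\<integral>\<^sup>+x. ?h (A *v x) \<partial>lborel)"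
    by (subst nn_integral_distr) simp_all
  finally have shift: "(\<integral>\<^sup>+x. ?h (A *v (x - b)) \<partial>lborel) = (\<integral>\<^sup>+x. ?h (A *v x) \<partial>lborel)" .
  have "ennreal \<bar>det A\<bar> * (\<integral>\<^sup>+x. ?h (A *v (x - b)) \<partial>lborel) = (\<integral>\<^sup>+x. ?h x \<partial>lborel)"
    unfolding shift by (rule nn_integral_linear_image[OF A, symmetric]) simp
  also have "\<dots> = ennreal (sqrt (2 * pi / t) ^ CARD('d))"
    using nn_integral_gaussian_euclidean[OF t, where 'a = "real ^ 'd"] by simp
  finally have eq: "ennreal \<bar>det A\<bar> * (\<integral>\<^sup>+x. ?h (A *v (x - b)) \<partial>lborel)
    = ennreal (sqrt (2 * pi / t) ^ CARD('d))" .
  have "(\<integral>\<^sup>+x. ?h (A *v (x - b)) \<partial>lborel)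
      = ennreal (1 / \<bar>det A\<bar>) * (ennreal \<bar>det A\<bar> * (\<integral>\<^sup>+x. ?h (A *v (x - b)) \<partial>lborel))"
    using A by (simp add: mult.assoc[symmetric] ennreal_mult[symmetric])
  also have "\<dots> = ennreal (sqrt (2 * pi / t) ^ CARD('d) / \<bar>det A\<bar>)"
    unfolding eq using A t by (simp add: ennreal_mult[symmetric])
  finally show ?thesis .
qed

lemma vol_Int_reflection_le:
  assumes K: "convex_body K"
  shows "vol (K \<inter> (\<lambda>y. x - y) ` K) \<le> Delta_KB K * vol K"
  using Delta_KB_is_max(2)[OF K, of x] convex_body_vol_pos[OF K]
  by (simp add: symmetry_ratio_def divide_le_eq)

lemma Delta_KB_nonneg:
  assumes K: "convex_body K"
  shows "Delta_KB K \<ge> 0"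
  using order_trans[OF _ Delta_KB_is_max(2)[OF K, of 0]] by (simp add: symmetry_ratio_def)

lemma isotropic_constant_pos:
  assumes K: "convex_body K"
  shows "isotropic_constant K > 0"
proof -
  have "det (covariance_matrix K) > 0" by (rule covariance_whitening[OF K])
  then show ?thesis
    using convex_body_vol_pos[OF K] by (simp add: isotropic_constant_def)
qed

lemma isotropic_constant_power:
  fixes K :: "(real ^ 'd) set"
  assumes K: "convex_body K"
  shows "isotropic_constant K ^ CARD('d) = sqrt (det (covariance_matrix K)) / vol K"
proof -
  have "det (covariance_matrix K) > 0" by (rule covariance_whitening[OF K])
  then show ?thesis
    unfolding isotropic_constant_def using convex_body_vol_pos[OF K]
    by (subst powr_realpow[symmetric]) (simp_all add: powr_powr)
qed

text \<open>
  The Gaussian test. Let \<open>\<mu>\<close> be the law of the average of \<open>n\<close> independent uniform points of \<open>K\<close>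
  and \<open>q\<close> the squared length in whitened coordinates around the barycenter. The mean of \<open>q\<close> under
  \<open>\<mu>\<close> is \<open>d / n\<close>, so by Jensen's inequality \<open>exp (- n q / 2)\<close> has mean at least \<open>exp (- d / 2)\<close>;
  on the other hand this mean is at most the bound on the density of \<open>\<mu>\<close> times the Lebesgue
  integral of the Gaussian. The determinant from that integral and the volume from the density
  combine into the isotropic constant.
\<close>

lemma self_average_gaussian_bound:
  fixes K :: "(real ^ 'd) set" and k :: nat
  assumes K: "convex_body K"
  defines "n \<equiv> 2 ^ k :: nat"
  shows "exp (- real CARD('d) / 2) \<le> (2 ^ CARD('d) * Delta_KB K) ^ (n - 1) *
      (isotropic_constant K * sqrt (2 * pi / n)) ^ CARD('d)"
proof -
  let ?d = "CARD('d)" and ?\<Sigma> = "covariance_matrix K" and ?b = "barycenter K"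
  let ?V = "vol K" and ?M = "2 ^ CARD('d) * Delta_KB K"
  have V: "?V > 0" by (rule convex_body_vol_pos[OF K])
  obtain A where A: "A ** ?\<Sigma> ** transpose A = mat 1" and dA: "det A \<noteq> 0"
    and sdet: "1 / \<bar>det A\<bar> = sqrt (det ?\<Sigma>)"
    by (rule covariance_whitening[OF K])
  define \<mu> where "\<mu> = (self_average ^^ k) (uniform_on K)"
  have n: "n > 0" "real n = 2 ^ k" by (simp_all add: n_def)
  have dens: "prob_space \<mu> \<and> sets \<mu> = sets borel \<and> (\<forall>g\<in>borel_measurable borel. (\<integral>\<^sup>+x. g x \<partial>\<mu>)
      \<le> ennreal ((1 / ?V) ^ n * (2 ^ DIM(real ^ 'd) * (Delta_KB K * ?V)) ^ (n - 1)) *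
        (\<integral>\<^sup>+x. g x * indicator K x \<partial>lborel))"
    unfolding \<mu>_def n_def
  proof (rule funpow_self_average_bound[OF prob_space_uniform_on[OF K] sets_uniform_on])
    show "K \<in> sets borel" using K by (simp add: convex_body_def compact_imp_closed)
    show "convex K" using K by (simp add: convex_body_def)
    show "Delta_KB K * ?V \<ge> 0" using Delta_KB_nonneg[OF K] V by simp
    show "emeasure lborel (K \<inter> (\<lambda>y. z - y) ` K) \<le> ennreal (Delta_KB K * ?V)" for z
    proof -
      have c: "compact (K \<inter> (\<lambda>y. z - y) ` K)"
        using K by (intro compact_Int_reflection) (simp add: convex_body_def)
      have "emeasure lborel (K \<inter> (\<lambda>y. z - y) ` K) = ennreal (vol (K \<inter> (\<lambda>y. z - y) ` K))"
        using emeasure_eq_ennreal_measure[OF fmeasurableD2[OF lmeasurable_compact[OF c]]]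
          compact_imp_closed[OF c] by simp
      then show ?thesis using vol_Int_reflection_le[OF K] by (simp add: ennreal_leI)
    qed
  qed (use V in \<open>simp_all add: nn_integral_uniform_on[OF K]\<close>)
  interpret prob_space \<mu> using dens by blast
  have [measurable_cong]: "sets \<mu> = sets borel" using dens by blast
  have "(1 / ?V) ^ n * (2 ^ DIM(real ^ 'd) * (Delta_KB K * ?V)) ^ (n - 1) = ?M ^ (n - 1) / ?V"
    using n(1) V by (cases n) (simp_all add: power_mult_distrib power_divide field_simps)
  then have dens: "(\<integral>\<^sup>+x. g x \<partial>\<mu>) \<le> ennreal (?M ^ (n - 1) / ?V) * (\<integral>\<^sup>+x. g x * indicator K x \<partial>lborel)"
    if "g \<in> borel_measurable borel" for g
    using dens that by auto

  define q where "q x = (norm (A *v (x - ?b)))\<^sup>2" for x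
  have q: "q x = (\<Sum>i\<in>UNIV. (row i A \<bullet> (x - ?b))\<^sup>2)" for x
    unfolding q_def power2_norm_eq_inner inner_vec_def
    by (simp add: matrix_vector_mult_def row_def power2_eq_square)
  have mom: "integrable \<mu> (\<lambda>x. (row i A \<bullet> (x - ?b))\<^sup>2) \<and>
      (\<integral>x. (row i A \<bullet> (x - ?b))\<^sup>2 \<partial>\<mu>) = 1 / n" for i
  proof -
    have "row i A \<bullet> (?\<Sigma> *v row i A) = (A ** ?\<Sigma> ** transpose A) $ i $ i"
      unfolding matrix_matrix_mult_def matrix_vector_mult_def transpose_def inner_vec_def row_def
      by (simp add: sum_distrib_left sum_distrib_right mult.assoc) (rule sum.swap)
    also have "\<dots> = 1" unfolding A by (simp add: mat_def)
    finally have "(\<integral>x. (row i A \<bullet> (x - ?b))\<^sup>2 \<partial>uniform_on K) = 1"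
      by (simp add: inner_covariance_matrix[OF K] power2_eq_square)
    moreover have "integrable \<mu> (\<lambda>x. (row i A \<bullet> (x - ?b))\<^sup>2) \<and> (\<integral>x. (row i A \<bullet> (x - ?b))\<^sup>2 \<partial>\<mu>)
        = (\<integral>x. (row i A \<bullet> (x - ?b))\<^sup>2 \<partial>uniform_on K) / 2 ^ k"
      unfolding \<mu>_def
    proof (rule funpow_self_average_moments[OF prob_space_uniform_on[OF K] sets_uniform_on])
      show "row i A \<bullet> ((1/2) *\<^sub>R (x + y) - ?b) = (row i A \<bullet> (x - ?b) + row i A \<bullet> (y - ?b)) / 2" for x y
        by (simp add: inner_diff_right inner_add_right field_simps)
      show "(\<lambda>x. row i A \<bullet> (x - ?b)) \<in> borel_measurable borel"
        by simp
    qed (intro integrable_uniform_on K continuous_intros mean_uniform_on)+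
    ultimately show ?thesis by (simp add: n)
  qed
  have qi: "integrable \<mu> q" unfolding q using mom by (intro Bochner_Integration.integrable_sum) blast
  have qm: "(\<integral>x. q x \<partial>\<mu>) = ?d / n"
    unfolding q using mom by (subst Bochner_Integration.integral_sum) auto

  let ?G = "\<lambda>x. exp (- real n * q x / 2)"
  have [measurable]: "q \<in> borel_measurable borel"
    unfolding q by measurable
  have q0: "q x \<ge> 0" for x by (simp add: q_def)
  have Gi: "integrable \<mu> ?G"
    by (rule integrable_const_bound[of _ 1]) (simp_all add: q0)
  \<comment> \<open>Jensen's inequality, through the tangent of the exponential at the mean \<open>- d / 2\<close> of the exponent.\<close>
  have tangent: "exp (- real ?d / 2) * (1 + ?d / 2 - n / 2 * q x) \<le> ?G x" for x
  proof -
    have "1 + (?d / 2 - n / 2 * q x) \<le> exp (?d / 2 - n / 2 * q x)" by (rule exp_ge_add_one_self)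
    then have "exp (- real ?d / 2) * (1 + (?d / 2 - n / 2 * q x)) \<le> exp (- real ?d / 2) * exp (?d / 2 - n / 2 * q x)"
      by (intro mult_left_mono) auto
    also have "\<dots> = ?G x" by (simp add: exp_add[symmetric])
    finally show ?thesis by (simp add: add_diff_eq)
  qed
  have "exp (- real ?d / 2) = (\<integral>x. exp (- real ?d / 2) * (1 + ?d / 2 - n / 2 * q x) \<partial>\<mu>)"
    using qi qm n(1) by (simp add: prob_space)
  also have "\<dots> \<le> (\<integral>x. ?G x \<partial>\<mu>)"
    using qi Gi tangent by (intro integral_mono) auto
  finally have "ennreal (exp (- real ?d / 2)) \<le> (\<integral>\<^sup>+x. ennreal (?G x) \<partial>\<mu>)"
    using Gi by (subst nn_integral_eq_integral) (auto intro: ennreal_leI)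
  also have "\<dots> \<le> ennreal (?M ^ (n - 1) / ?V) * (\<integral>\<^sup>+x. ennreal (?G x) * indicator K x \<partial>lborel)"
    by (rule dens) simp
  also have "\<dots> \<le> ennreal (?M ^ (n - 1) / ?V) * (\<integral>\<^sup>+x. ennreal (?G x) \<partial>lborel)"
    by (intro mult_left_mono nn_integral_mono) (auto simp: indicator_def)
  also have "(\<integral>\<^sup>+x. ennreal (?G x) \<partial>lborel) = ennreal (sqrt (2 * pi / n) ^ ?d / \<bar>det A\<bar>)"
    unfolding q_def by (rule nn_integral_gaussian_affine) (use n dA in auto)
  also have "ennreal (?M ^ (n - 1) / ?V) * \<dots> = ennreal (?M ^ (n - 1) / ?V * (sqrt (2 * pi / n) ^ ?d / \<bar>det A\<bar>))"
    using V Delta_KB_nonneg[OF K] by (intro ennreal_mult[symmetric]) auto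
  finally have "exp (- real ?d / 2) \<le> ?M ^ (n - 1) / ?V * (sqrt (2 * pi / n) ^ ?d / \<bar>det A\<bar>)"
    using V Delta_KB_nonneg[OF K] by (subst (asm) ennreal_le_iff) auto
  also have "\<dots> = ?M ^ (n - 1) * (isotropic_constant K ^ ?d * sqrt (2 * pi / n) ^ ?d)"
    unfolding isotropic_constant_power[OF K] sdet[symmetric] by simp
  finally show "exp (- real ?d / 2) \<le> ?M ^ (n - 1) * (isotropic_constant K * sqrt (2 * pi / n)) ^ ?d"
    by (simp add: power_mult_distrib)
qed

lemma exists_power_two_between:
  fixes T :: real
  obtains k :: nat where "T \<le> 2 ^ k" "k = 0 \<or> 2 ^ k < 2 * T"
proof -
  have ex: "\<exists>k. T \<le> 2 ^ k"
    by (metis less_imp_le one_less_numeral_iff real_arch_pow semiring_norm(76))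
  define k where "k = (LEAST k. T \<le> 2 ^ k)"
  have "T \<le> 2 ^ k" unfolding k_def using ex by (rule LeastI_ex)
  moreover have "k = 0 \<or> 2 ^ k < 2 * T"
  proof (cases k)
    case (Suc j)
    have "\<not> T \<le> 2 ^ j" using not_less_Least[of j "\<lambda>k. T \<le> 2 ^ k"] Suc by (simp add: k_def)
    then show ?thesis using Suc by simp
  qed simp
  ultimately show thesis by (rule that)
qed

theorem theorem1p3:
  fixes K :: "(real ^ 'd) set"
  assumes "convex_body K"
  shows "Delta_KB K \<ge>
    exp (real CARD('d) / (2 ^ 15 * (isotropic_constant K)\<^sup>2)) * 2 powr (- real CARD('d))"
proof -
  let ?d = "CARD('d)" and ?L = "isotropic_constant K"
  define M where "M = 2 ^ ?d * Delta_KB K"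
  define x where "x = ?d / (2 ^ 15 * ?L\<^sup>2)"
  have L: "?L > 0" by (rule isotropic_constant_pos[OF assms])
  have M: "M \<ge> 0" unfolding M_def using Delta_KB_nonneg[OF assms] by simp
  \<comment> \<open>From this size of \<open>n\<close> on, \<open>?L * sqrt (2 * pi / n)\<close> is at most \<open>exp (- 1)\<close>.\<close>
  define T where "T = 2 * pi * exp 2 * ?L\<^sup>2"
  obtain k where k: "T \<le> 2 ^ k" "k = 0 \<or> 2 ^ k < 2 * T"
    using exists_power_two_between by blast
  define n where "n = (2 ^ k :: nat)"
  have n: "real n = 2 ^ k" "n > 0" by (simp_all add: n_def)
  have "(?L * sqrt (2 * pi / n))\<^sup>2 = T / n * (exp (- 1))\<^sup>2"
    using n by (simp add: T_def power_mult_distrib exp_double[symmetric] mult_exp_exp)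
  also have "\<dots> \<le> 1 * (exp (- 1))\<^sup>2"
    using k n by (intro mult_right_mono) (auto simp: divide_le_eq)
  finally have "(?L * sqrt (2 * pi / n))\<^sup>2 \<le> (exp (- 1))\<^sup>2"
    unfolding mult_1 .
  then have "?L * sqrt (2 * pi / n) \<le> exp (- 1)"
    by (rule power2_le_imp_le) simp
  then have "(?L * sqrt (2 * pi / n)) ^ ?d \<le> exp (- 1) ^ ?d"
    using L by (intro power_mono) auto
  then have "M ^ (n - 1) * (?L * sqrt (2 * pi / n)) ^ ?d \<le> M ^ (n - 1) * exp (- real ?d)"
    using M by (intro mult_left_mono) (auto simp: exp_of_nat_mult[symmetric])
  with self_average_gaussian_bound[OF assms, of k]
  have "exp (- real ?d / 2) \<le> M ^ (n - 1) * exp (- real ?d)"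
    by (simp add: M_def n_def)
  then have "exp (- real ?d / 2) * exp ?d \<le> M ^ (n - 1) * exp (- real ?d) * exp ?d"
    by (rule mult_right_mono) simp
  then have big: "exp (?d / 2) \<le> M ^ (n - 1)"
    by (simp add: mult_exp_exp mult.assoc)
  \<comment> \<open>For \<open>n = 1\<close> the bound just obtained is absurd, hence \<open>k\<close> is not the default value and
    minimality of \<open>k\<close> bounds \<open>n\<close> from above.\<close>
  have "n \<noteq> 1"
  proof
    assume "n = 1"
    then have "exp (?d / 2) \<le> 1" using big by simp
    then show False by simp
  qed
  then have "k \<noteq> 0" by (auto simp: n_def)
  then have nT: "n < 2 * T" using k n by simp
  have "exp 2 = (exp (1 :: real))\<^sup>2" by (simp add: exp_double[symmetric])
  also have "\<dots> \<le> (3 :: real)\<^sup>2" using exp_le by (intro power_mono) auto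
  finally have "pi * exp 2 \<le> 4 * (9 :: real)"
    using pi_less_4 by (intro mult_mono) auto
  then have "pi * exp 2 * ?L\<^sup>2 \<le> 36 * ?L\<^sup>2" by (intro mult_right_mono) auto
  then have "2 * real n \<le> 2 ^ 15 * ?L\<^sup>2"
    using nT zero_le_power2[of ?L] by (simp add: T_def)
  then have x: "x \<le> ?d / (2 * n)"
    unfolding x_def using n L by (intro divide_left_mono) auto
  have "exp x \<le> M"
  proof (rule ccontr)
    assume "\<not> exp x \<le> M"
    then have "M ^ (n - 1) \<le> exp x ^ (n - 1)"
      using M by (intro power_mono) auto
    also have "\<dots> = exp ((n - 1) * x)" by (simp add: exp_of_nat_mult)
    also have "\<dots> < exp (?d / 2)"
    proof -
      have "real (n - 1) * x \<le> real (n - 1) * (?d / (2 * n))"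
        using x by (intro mult_left_mono) auto
      also have "\<dots> < n * (?d / (2 * n))"
        using n by (intro mult_strict_right_mono) auto
      also have "\<dots> = ?d / 2" using n by simp
      finally show ?thesis by simp
    qed
    finally show False using big by simp
  qed
  then show ?thesis
    by (simp add: x_def M_def powr_minus powr_realpow field_simps)
qed

end
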